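(* Let $K_1, K_2$ be compact Hausdorff spaces and let $E$ be a Banach space with nontrivial cotype. If $\mathcal{C}(K_1)$ is isomorphically embedded into $\mathcal{C}(K_2,E)$ and $s(K_1)$ is infinite, then $s(K_1)\le s(K_2)$.
   Context: For a compact space $K$ and a Banach space $E$, $\mathcal{C}(K,E)$ is the Banach space of continuous functions $K\to E$ with the sup-norm, and $\mathcal{C}(K)=\mathcal{C}(K,\mathbb{R})$. An isomorphic embedding is a bounded linear map that is an isomorphism onto its range. The spread of a topological space $X$ is $s(X)=\sup\{|D|: D\subseteq X,\ D\text{ is discrete in the inherited topology}\}$. A Banach space $E$ has nontrivial cotype if there are a real number $q\ge 2$ and a constant $C>0$ such that for all $n\in\mathbb{N}$ and $e_1,\dots,e_n\in E$, $\left(\sum_{i=1}^n\|e_i\|^q\right)^{1/q}\le C\left(\int_0^1\left\|\sum_{i=1}^n r_i(t)e_i\right\|^2dt\right)^{1/2}$, where $r_i(t)=\operatorname{sign}(\sin(2^i\pi t))$ are the Rademacher functions. *)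

theory Defs
  imports "HOL-Analysis.Analysis"
begin

unbundle cardinal_syntax

text \<open>
  \<open>spread S\<close> is the supremum, in the class of cardinals, of \<open>|D|\<close> over the relatively discrete
  \<open>D \<subseteq> S\<close>. Cardinals are well-orders in the sense of \<^const>\<open>Card_order\<close>, so the supremum is
  determined only up to \<open>=o\<close> and one representative on the ambient type is chosen. Such a
  representative exists because \<open>|S|\<close> is an upper bound, and it is also least among the upper
  bounds living on other types; both facts are proved below.
\<close>

definition spread :: "'a::topological_space set \<Rightarrow> 'a rel" where
  "spread S = (SOME r. Card_order r \<and> (\<forall>D\<subseteq>S. discrete D \<longrightarrow> |D| \<le>o r) \<and>
     (\<forall>r' :: 'a rel. Card_order r' \<and> (\<forall>D\<subseteq>S. discrete D \<longrightarrow> |D| \<le>o r') \<longrightarrow> r \<le>o r'))"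

lemma spread_is_least:
  fixes S :: "'a::topological_space set"
  shows "Card_order (spread S) \<and> (\<forall>D\<subseteq>S. discrete D \<longrightarrow> |D| \<le>o spread S) \<and>
    (\<forall>r' :: 'a rel. Card_order r' \<and> (\<forall>D\<subseteq>S. discrete D \<longrightarrow> |D| \<le>o r') \<longrightarrow> spread S \<le>o r')"
proof -
  let ?R = "{r :: 'a rel. Card_order r \<and> (\<forall>D\<subseteq>S. discrete D \<longrightarrow> |D| \<le>o r)}"
  have "|S| \<in> ?R"
    by (simp add: card_of_Card_order card_of_mono1)
  then have "\<exists>r\<in>?R. \<forall>r'\<in>?R. r \<le>o r'"
    by (intro exists_minim_Card_order) auto
  then have "\<exists>r :: 'a rel. Card_order r \<and> (\<forall>D\<subseteq>S. discrete D \<longrightarrow> |D| \<le>o r) \<and>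
      (\<forall>r' :: 'a rel. Card_order r' \<and> (\<forall>D\<subseteq>S. discrete D \<longrightarrow> |D| \<le>o r') \<longrightarrow> r \<le>o r')"
    by (simp only: Bex_def Ball_def mem_Collect_eq conj_assoc)
  from someI_ex[OF this] show ?thesis
    unfolding spread_def .
qed

lemma Card_order_spread: "Card_order (spread S)"
  and card_of_discrete_le_spread: "D \<subseteq> S \<Longrightarrow> discrete D \<Longrightarrow> |D| \<le>o spread S"
  using spread_is_least[of S] by simp_all

lemma spread_least:
  fixes S :: "'a::topological_space set" and r :: "'b rel"
  assumes r: "Card_order r" and ub: "\<And>D. D \<subseteq> S \<Longrightarrow> discrete D \<Longrightarrow> |D| \<le>o r"
  shows "spread S \<le>o r"
proof (rule ccontr)
  assume contr: "\<not> spread S \<le>o r"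
  have "r <o spread S"
    using contr not_ordLeq_iff_ordLess[OF card_order_on_well_order_on[OF r]
      card_order_on_well_order_on[OF Card_order_spread[of S]]] by simp
  then obtain r' :: "'a rel" where r': "(r, r') \<in> ordIso" "r' <o spread S"
    unfolding internalize_ordLess[of r "spread S"] by blast
  have c: "Card_order r'"
    by (rule Card_order_ordIso2[OF r r'(1)])
  have u: "|D| \<le>o r'" if "D \<subseteq> S" "discrete D" for D
    by (rule ordLeq_ordIso_trans[OF ub[OF that] r'(1)])
  have "spread S \<le>o r'"
    by (rule spread_is_least[of S, THEN conjunct2, THEN conjunct2, rule_format])
      (intro conjI allI impI c u; assumption)
  then show False
    by (rule not_ordLess_ordLeq[OF r'(2), THEN notE])
qed

text \<open>
  The inverse \<open>S\<close> of the linear map \<open>T\<close> on its range is automatically linear there, so its continuity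
  makes \<open>T\<close> an isomorphism of normed spaces onto its range.
\<close>

definition isomorphic_embedding ::
    "('a::real_normed_vector \<Rightarrow> 'b::real_normed_vector) \<Rightarrow> bool" where
  "isomorphic_embedding T \<longleftrightarrow>
     bounded_linear T \<and> (\<exists>S. homeomorphism UNIV (range T) T S)"

definition rademacher :: "nat \<Rightarrow> real \<Rightarrow> real" where
  "rademacher i t = sgn (sin (2 ^ i * pi * t))"

definition nontrivial_cotype :: "'e::real_normed_vector itself \<Rightarrow> bool" where
  "nontrivial_cotype _ \<longleftrightarrow>
     (\<exists>q::real. \<exists>C::real. q \<ge> 2 \<and> C > 0 \<and>
       (\<forall>(n::nat) (e :: nat \<Rightarrow> 'e).
          (\<Sum>i=1..n. norm (e i) powr q) powr (1 / q)
            \<le> C * sqrt (integral {0..1} (\<lambda>t. (norm (\<Sum>i=1..n. rademacher i t *\<^sub>R e i))\<^sup>2))))"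

end

theory Submission
  imports Defs
begin

text \<open>
  Let \<open>T\<close> be the embedding. For each \<open>d\<close> there is a point \<open>y\<^sub>d\<close> of the second space at which \<open>T\<close> has
  an atom at \<open>d\<close>: however small a neighbourhood of \<open>d\<close>, some function of norm at most \<open>1\<close>
  supported there has an image of norm greater than a fixed \<open>\<eta>\<close> at \<open>y\<^sub>d\<close>. Cotype bounds the number
  \<open>n\<close> of disjointly supported functions of norm at most \<open>1\<close> whose images all exceed \<open>\<eta>\<close> in norm at
  one common point. Given a discrete set \<open>D\<close>, a point \<open>y\<^sub>d\<close> surviving \<open>n\<close> Cantor-Bendixson
  derivatives of the family \<open>(y\<^sub>d)\<close> would produce more such functions: pass successively to nearby
  points \<open>y\<^sub>e\<close> and choose supports around each new \<open>e\<close> that avoid the earlier ones, which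
  discreteness of \<open>D\<close> allows. So the family is exhausted after finitely many derivatives; each layer
  is finite-to-one onto a discrete set, and one of them has the cardinality of \<open>D\<close>.
\<close>

section \<open>Compact Hausdorff spaces\<close>

text \<open>Compactness gives a limit point \<open>p\<close>. Points are picked ever closer to
  \<open>p\<close>, each separated from a smaller neighbourhood of \<open>p\<close> in which all
  later choices take place; the separating open sets are pairwise disjoint and isolate the
  points.\<close>

lemma infinite_compact_imp_infinite_discrete:
  assumes "compact (UNIV :: 'a::t2_space set)" and "infinite (UNIV :: 'a set)"
  shows "\<exists>D :: 'a set. infinite D \<and> discrete D"
proof -
  obtain p :: 'a where p: "p islimpt UNIV"
    using Heine_Borel_imp_Bolzano_Weierstrass[OF assms] by auto
  \<comment> \<open>A state is a point \<open>x\<close>, its isolating set \<open>V\<close> and the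
    neighbourhood \<open>U\<close> of \<open>p\<close> left for later states.\<close>
  let ?P = "\<lambda>s. case s of (x, V, U) \<Rightarrow> open U \<and> p \<in> U \<and> open V \<and> x \<in> V \<and> V \<inter> U = {}"
  let ?Q = "\<lambda>s s'. case s of (x, V, U) \<Rightarrow> case s' of (x', V', U') \<Rightarrow> V' \<subseteq> U \<and> U' \<subseteq> (U :: 'a set)"
  have step: "\<exists>s'. ?P s' \<and> (case s' of (x', V', U') \<Rightarrow> V' \<subseteq> U \<and> U' \<subseteq> U)"
    if U: "open U" "p \<in> U" for U
  proof -
    obtain x where x: "x \<in> U" "x \<noteq> p"
      using islimptE[OF p U(2,1)] by auto
    obtain A B where "open A" "open B" "x \<in> A" "p \<in> B" "A \<inter> B = {}"
      using hausdorff[OF x(2)] by blast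
    then show ?thesis
      using x U by (intro exI[of _ "(x, A \<inter> U, B \<inter> U)"]) (auto intro!: open_Int)
  qed
  have "\<exists>s. \<forall>n. ?P (s n) \<and> ?Q (s n) (s (Suc n))"
  proof (rule dependent_nat_choice)
    show "\<exists>s. ?P s"
      using step[of UNIV] by auto
    show "\<exists>s'. ?P s' \<and> ?Q s s'" if "?P s" for s n
      using step[of "snd (snd s)"] that by (simp add: case_prod_unfold)
  qed
  then obtain s where s: "\<forall>n. ?P (s n) \<and> ?Q (s n) (s (Suc n))"
    by (rule exE)
  define x V U where "x n = fst (s n)" and "V n = fst (snd (s n))" and "U n = snd (snd (s n))" for n
  have V: "open (V n)" "x n \<in> V n" "V n \<inter> U n = {}" for n
    using conjunct1[OF spec[OF s, of n]] by (simp_all add: x_def V_def U_def case_prod_unfold)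
  have sub: "V (Suc n) \<subseteq> U n" "U (Suc n) \<subseteq> U n" for n
    using conjunct2[OF spec[OF s, of n]] by (simp_all add: V_def U_def case_prod_unfold)
  have VU: "V n \<subseteq> U m" if "m < n" for m n
  proof -
    have "V n \<subseteq> U (n - 1)"
      using sub(1)[of "n - 1"] that by simp
    also have "\<dots> \<subseteq> U m"
      using lift_Suc_antimono_le[of U m "n - 1"] sub(2) that by auto
    finally show ?thesis .
  qed
  have disj: "x m \<notin> V n" if "m \<noteq> n" for m n
    using VU[of m n] VU[of n m] V(2,3)[of m] V(3)[of n] that by (cases "m < n") auto
  have "inj x"
    using disj V(2) by (metis injI)
  moreover have "discrete (range x)"
  proof (rule discreteI)
    fix y assume "y \<in> range x"
    then obtain n where n: "y = x n"
      by blast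
    have "V n \<inter> range x = {x n}"
      using disj V(2)[of n] by (auto; metis)
    then show "y isolated_in range x"
      using V(1)[of n] n by (auto simp: isolated_in_def)
  qed
  ultimately show ?thesis
    using range_inj_infinite by blast
qed

text \<open>A Urysohn function with a plateau: being constant near \<open>d\<close>, and not just at
  \<open>d\<close>, lets later bumps live where earlier ones are constant.\<close>

definition bump :: "real \<Rightarrow> 'a::topological_space \<Rightarrow> 'a set \<Rightarrow> ('a \<Rightarrow> real) \<Rightarrow> bool" where
  "bump a d U f \<longleftrightarrow> continuous_on UNIV f \<and> (\<forall>x. 0 \<le> f x \<and> f x \<le> a) \<and>
     (\<exists>V. open V \<and> d \<in> V \<and> (\<forall>x\<in>V. f x = a)) \<and> (\<forall>x. x \<notin> U \<longrightarrow> f x = 0)"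

lemma bump_exists:
  fixes d :: "'a::t2_space"
  assumes "compact (UNIV :: 'a set)" and "open U" and "d \<in> U"
  shows "\<exists>f. bump 1 d U f"
proof -
  have "normal_space (euclidean :: 'a topology)"
  proof (rule compact_Hausdorff_or_regular_imp_normal_space)
    show "compact_space (euclidean :: 'a topology)"
      using assms(1) by (simp add: compact_space_def)
    show "Hausdorff_space (euclidean :: 'a topology) \<or> regular_space (euclidean :: 'a topology)"
      unfolding Hausdorff_space_def using hausdorff by (auto simp: disjnt_def)
  qed
  \<comment> \<open>Values up to 2 leave room for truncation at 1, which turns the open set
    \<open>{x. 1 < g x}\<close> into a plateau.\<close>
  then obtain g :: "'a \<Rightarrow> real"
    where g: "continuous_map euclidean (top_of_set {0..2}) g" "g ` (- U) \<subseteq> {0}" "g ` {d} \<subseteq> {2}"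
  proof (rule Urysohn_lemma)
    show "closedin euclidean (- U)" and "disjnt (- U) {d}"
      using assms(2,3) by (auto simp: disjnt_def)
    show "(0 :: real) \<le> 2"
      by simp
  qed auto
  have cont: "continuous_on UNIV g" and "\<And>x. 0 \<le> g x"
    using g(1) by (auto simp: continuous_map_in_subtopology)
  moreover have "open {x. 1 < g x}"
    using cont by (intro open_Collect_less continuous_intros)
  moreover have "g d = 2" and "\<And>x. x \<notin> U \<Longrightarrow> g x = 0"
    using g(2,3) by auto
  ultimately have "bump 1 d U (\<lambda>x. min 1 (g x))"
    unfolding bump_def by (auto intro!: continuous_intros exI[of _ "{x. 1 < g x}"])
  then show ?thesis
    by (rule exI[of "bump 1 d U"])
qed

lemma bump_cont: "bump a d U f \<Longrightarrow> continuous_on UNIV f"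
  and bump_ge0: "bump a d U f \<Longrightarrow> 0 \<le> f x"
  and bump_le: "bump a d U f \<Longrightarrow> f x \<le> a"
  and bump_off: "bump a d U f \<Longrightarrow> x \<notin> U \<Longrightarrow> f x = 0"
  by (auto simp: bump_def)

lemma bump_centre: "bump a d U f \<Longrightarrow> f d = a"
  by (auto simp: bump_def)

lemma bump_mono: "bump a d U f \<Longrightarrow> U \<subseteq> U' \<Longrightarrow> bump a d U' f"
  by (auto simp: bump_def)

lemma bump_add:
  assumes "bump a d U f" and "bump b d U g"
  shows "bump (a + b) d U (\<lambda>x. f x + g x)"
proof -
  obtain V W where "open V" "d \<in> V" "\<forall>x\<in>V. f x = a" "open W" "d \<in> W" "\<forall>x\<in>W. g x = b"
    using assms unfolding bump_def by blast
  then have "\<exists>V. open V \<and> d \<in> V \<and> (\<forall>x\<in>V. f x + g x = a + b)"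
    by (intro exI[of _ "V \<inter> W"]) auto
  then show ?thesis
    using assms by (auto simp: bump_def intro!: continuous_intros add_mono)
qed

lemma bump_scale:
  assumes "bump a d U f" and "0 < a"
  shows "bump 1 d U (\<lambda>x. (1 / a) * f x)"
  using assms by (auto simp: bump_def divide_simps intro!: continuous_intros)

lemma bump_nbhd:
  assumes "bump a d U f"
  obtains V where "open V" and "d \<in> V" and "\<forall>x\<in>V. f x = a"
  using assms unfolding bump_def by blast

section \<open>Operators bounded on disjoint families\<close>

definition unit_fun :: "('a::topological_space \<Rightarrow> real) \<Rightarrow> bool" where
  "unit_fun f \<longleftrightarrow> continuous_on UNIV f \<and> (\<forall>x. \<bar>f x\<bar> \<le> 1)"

lemma bump_unit_fun: "bump 1 d U f \<Longrightarrow> unit_fun f"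
  by (auto simp: bump_def unit_fun_def)

text \<open>The recursion removes each support \<open>B\<close> from \<open>A\<close>, which is the
  order in which the inductions below produce disjointly supported functions.\<close>

fun packed :: "(('a::topological_space \<Rightarrow> real) \<Rightarrow> 'b \<Rightarrow> 'e::real_normed_vector) \<Rightarrow> real \<Rightarrow>
    nat \<Rightarrow> 'a set \<Rightarrow> 'b \<Rightarrow> bool" where
  "packed S \<eta> 0 A y \<longleftrightarrow> True"
| "packed S \<eta> (Suc n) A y \<longleftrightarrow> (\<exists>B h. B \<subseteq> A \<and> unit_fun h \<and> (\<forall>x. x \<notin> B \<longrightarrow> h x = 0) \<and>
     norm (S h y) > \<eta> \<and> packed S \<eta> n (A - B) y)"

lemma packed_mono: "packed S \<eta> n A y \<Longrightarrow> A \<subseteq> A' \<Longrightarrow> packed S \<eta> n A' y"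
proof (induction n arbitrary: A A')
  case (Suc n)
  then obtain B h where "B \<subseteq> A" "unit_fun h" "\<forall>x. x \<notin> B \<longrightarrow> h x = 0" "norm (S h y) > \<eta>"
    and "packed S \<eta> n (A - B) y"
    unfolding packed.simps by blast
  moreover from this have "packed S \<eta> n (A' - B) y"
    using Suc.IH Suc.prems(2) by (meson Diff_mono order_refl)
  ultimately show ?case
    using Suc.prems(2) unfolding packed.simps by (meson subset_trans)
qed simp

lemma packed_family:
  assumes "packed S \<eta> n A y"
  shows "\<exists>f. (\<forall>i\<in>{1..n}. unit_fun (f i) \<and> norm (S (f i) y) > \<eta> \<and> (\<forall>x. x \<notin> A \<longrightarrow> f i x = 0)) \<and>
    (\<forall>x. \<forall>i\<in>{1..n}. \<forall>j\<in>{1..n}. i \<noteq> j \<longrightarrow> f i x = 0 \<or> f j x = 0)"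
  using assms
proof (induction n arbitrary: A)
  case (Suc n)
  from Suc.prems obtain B h where h: "B \<subseteq> A" "unit_fun h" "\<And>x. x \<notin> B \<Longrightarrow> h x = 0"
    "norm (S h y) > \<eta>" and p: "packed S \<eta> n (A - B) y"
    unfolding packed.simps by blast
  obtain f where *: "(\<forall>i\<in>{1..n}. unit_fun (f i) \<and> norm (S (f i) y) > \<eta> \<and> (\<forall>x. x \<notin> A - B \<longrightarrow> f i x = 0)) \<and>
      (\<forall>x. \<forall>i\<in>{1..n}. \<forall>j\<in>{1..n}. i \<noteq> j \<longrightarrow> f i x = 0 \<or> f j x = 0)"
    using Suc.IH[OF p] by (rule exE)
  have f: "unit_fun (f i)" "norm (S (f i) y) > \<eta>" "x \<notin> A - B \<Longrightarrow> f i x = 0"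
    if "i \<in> {1..n}" for i x
    using * that by blast+
  have disj: "f i x = 0 \<or> f j x = 0" if "i \<in> {1..n}" "j \<in> {1..n}" "i \<noteq> j" for i j x
    using * that by blast
  define f' where "f' = f(Suc n := h)"
  have new: "f' (Suc n) = h" and old: "\<And>i. i \<in> {1..n} \<Longrightarrow> f' i = f i"
    by (auto simp: f'_def)
  have split: "i \<in> {1..n} \<or> i = Suc n" if "i \<in> {1..Suc n}" for i
    using that by auto
  have "unit_fun (f' i) \<and> norm (S (f' i) y) > \<eta> \<and> (\<forall>x. x \<notin> A \<longrightarrow> f' i x = 0)"
    if "i \<in> {1..Suc n}" for i
    using split[OF that]
  proof
    assume i: "i \<in> {1..n}"
    then show ?thesis
      using f[OF i] old[OF i] by simp
  next
    assume "i = Suc n"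
    then show ?thesis
      using h new by auto
  qed
  moreover have "f' i x = 0 \<or> f' j x = 0"
    if i: "i \<in> {1..Suc n}" and j: "j \<in> {1..Suc n}" and "i \<noteq> j" for x i j
  proof (cases "x \<in> B")
    case True
    then have "f' k x = 0" if "k \<in> {1..n}" for k
      using f(3)[OF that, of x] old[OF that] by simp
    then show ?thesis
      using split[OF i] split[OF j] \<open>i \<noteq> j\<close> by blast
  next
    case False
    then have "f' (Suc n) x = 0"
      using h(3) new by simp
    then show ?thesis
      using split[OF i] split[OF j] disj[of i j x] old \<open>i \<noteq> j\<close> by force
  qed
  ultimately show ?case
    by blast
qed simp

text \<open>What the topological argument uses of the embedding: \<open>below\<close> stands for
  continuity of the inverse, \<open>not_packed\<close> for cotype.\<close>

locale disjointly_bounded =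
  fixes S :: "('a::t2_space \<Rightarrow> real) \<Rightarrow> 'b::t2_space \<Rightarrow> 'e::real_normed_vector"
    and M \<eta> :: real and N :: nat
  assumes compact_dom: "compact (UNIV :: 'a set)"
    and compact_cod: "compact (UNIV :: 'b set)"
    and lin: "\<lbrakk>continuous_on UNIV f; continuous_on UNIV g\<rbrakk> \<Longrightarrow>
      S (\<lambda>x. a * f x + b * g x) y = a *\<^sub>R S f y + b *\<^sub>R S g y"
    and cont: "continuous_on UNIV f \<Longrightarrow> continuous_on UNIV (S f)"
    and bound: "unit_fun f \<Longrightarrow> norm (S f y) \<le> M"
    and below: "\<lbrakk>continuous_on UNIV f; f x = 1\<rbrakk> \<Longrightarrow> \<exists>y. norm (S f y) \<ge> 4 * \<eta>"
    and eta_pos: "\<eta> > 0"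
    and not_packed: "\<not> packed S \<eta> (Suc N) UNIV y"
begin

lemma S_add: "\<lbrakk>continuous_on UNIV f; continuous_on UNIV g\<rbrakk> \<Longrightarrow> S (\<lambda>x. f x + g x) y = S f y + S g y"
  using lin[of f g 1 1 y] by simp

lemma S_diff: "\<lbrakk>continuous_on UNIV f; continuous_on UNIV g\<rbrakk> \<Longrightarrow> S (\<lambda>x. f x - g x) y = S f y - S g y"
  using lin[of f g 1 "-1" y] by simp

lemma S_scale: "continuous_on UNIV f \<Longrightarrow> S (\<lambda>x. a * f x) y = a *\<^sub>R S f y"
  using lin[of f f a 0 y] by simp

lemma S_zero: "S (\<lambda>x. 0) y = 0"
  using S_scale[of "\<lambda>x. 0" 0 y] by simp

lemma M_nonneg: "0 \<le> M"
  using bound[of "\<lambda>x. 0" undefined] S_zero[of undefined] by (simp add: unit_fun_def)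

lemma open_level: "continuous_on UNIV f \<Longrightarrow> open {y. c < norm (S f y)}"
  by (intro open_Collect_less continuous_intros cont)

lemma closed_level: "continuous_on UNIV f \<Longrightarrow> closed {y. c \<le> norm (S f y)}"
  by (intro closed_Collect_le continuous_intros cont)

text \<open>
  The threshold \<open>3 * \<eta>\<close> lies below the norm \<open>4 * \<eta>\<close> that every bump attains, and it exceeds the
  target \<open>\<eta>\<close> by enough to absorb the error \<open>\<eta>\<close> made when a function is cut off near \<open>d\<close>.
\<close>

definition negligible_at :: "'a \<Rightarrow> 'b set \<Rightarrow> bool" where
  "negligible_at d A \<longleftrightarrow> (\<forall>U \<rho>. open U \<and> d \<in> U \<and> 3 * \<eta> < \<rho> \<longrightarrow>
     (\<exists>f. bump 1 d U f \<and> (\<forall>y\<in>A. norm (S f y) < \<rho>)))"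

section \<open>The ideal of sets negligible at a point\<close>

lemma negligible_atD:
  assumes "negligible_at d A" "open U" "d \<in> U" "3 * \<eta> < \<rho>"
  obtains f where "bump 1 d U f" "\<forall>y\<in>A. norm (S f y) < \<rho>"
proof -
  have "\<exists>f. bump 1 d U f \<and> (\<forall>y\<in>A. norm (S f y) < \<rho>)"
    using assms unfolding negligible_at_def by simp
  then show ?thesis
    using that by (elim exE conjE)
qed

lemma negligible_at_mono: "negligible_at d A \<Longrightarrow> B \<subseteq> A \<Longrightarrow> negligible_at d B"
  unfolding negligible_at_def by (elim all_forward imp_forward ex_forward) auto

lemma negligible_at_empty: "negligible_at d {}"
  unfolding negligible_at_def using bump_exists[OF compact_dom] by simp

lemma not_negligible_at_UNIV: "\<not> negligible_at d UNIV"
proof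
  assume "negligible_at d UNIV"
  then obtain f where f: "bump 1 d UNIV f" "\<And>y. norm (S f y) < 4 * \<eta>"
    using eta_pos by (elim negligible_atD[of d UNIV UNIV "4 * \<eta>"]) auto
  then show False
    using below[of f d] bump_cont[OF f(1)] bump_centre[OF f(1)] by (meson not_le)
qed

text \<open>For means of \<open>n\<close> functions: an error \<open>M\<close> made once in the sum
  costs only \<open>M / n\<close> in the mean, which fits between \<open>\<rho>'\<close> and
  \<open>\<rho>\<close>.\<close>

lemma archimedean_average:
  assumes "(\<rho>'::real) < \<rho>"
  obtains n :: nat where "0 < n" and "real n * \<rho>' + M < real n * \<rho>"
proof -
  obtain n :: nat where "M / (\<rho> - \<rho>') < real n"
    using reals_Archimedean2 by blast
  then have "M < real n * (\<rho> - \<rho>')"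
    using assms by (simp add: field_simps)
  moreover from this have "0 < n"
    using M_nonneg by (cases n) auto
  ultimately show ?thesis
    using that by (simp add: algebra_simps)
qed

text \<open>
  An average of bumps small on \<open>A\<close> and bumps small on \<open>B\<close>, nested so that the alternating sum
  \<open>F - H\<close> stays in the unit ball, forces both \<open>S F\<close> and \<open>S H\<close> to be small on all of \<open>A \<union> B\<close>.
\<close>

lemma alternating_bumps:
  assumes A: "negligible_at d A" and B: "negligible_at d B" and \<rho>: "3 * \<eta> < \<rho>"
    and U: "open U" "d \<in> U"
  shows "\<exists>F H. bump (real n) d U F \<and> bump (real n) d U H \<and> (\<forall>x. 0 \<le> F x - H x \<and> F x - H x \<le> 1) \<and>
    (\<forall>y\<in>A. norm (S F y) \<le> real n * \<rho>) \<and> (\<forall>y\<in>B. norm (S H y) \<le> real n * \<rho>)"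
  using U
proof (induction n arbitrary: U)
  case 0
  then show ?case
    by (intro exI[of _ "\<lambda>x. 0"]) (auto simp: bump_def S_zero)
next
  case (Suc n)
  obtain f where f: "bump 1 d U f" "\<forall>y\<in>A. norm (S f y) < \<rho>"
    by (rule negligible_atD[OF A Suc.prems \<rho>])
  obtain V where V: "open V" "d \<in> V" "\<forall>x\<in>V. f x = 1"
    by (rule bump_nbhd[OF f(1)])
  obtain g where g: "bump 1 d (U \<inter> V) g" "\<forall>y\<in>B. norm (S g y) < \<rho>"
    by (rule negligible_atD[OF B open_Int[OF Suc.prems(1) V(1)] IntI[OF Suc.prems(2) V(2)] \<rho>])
  obtain W where W: "open W" "d \<in> W" "\<forall>x\<in>W. g x = 1"
    by (rule bump_nbhd[OF g(1)])
  obtain F H where F: "bump (real n) d (U \<inter> V \<inter> W) F" and H: "bump (real n) d (U \<inter> V \<inter> W) H"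
    and FH: "\<forall>x. 0 \<le> F x - H x \<and> F x - H x \<le> 1"
    and FA: "\<forall>y\<in>A. norm (S F y) \<le> real n * \<rho>"
    and HB: "\<forall>y\<in>B. norm (S H y) \<le> real n * \<rho>"
    using Suc.IH[OF open_Int[OF open_Int[OF Suc.prems(1) V(1)] W(1)]
        IntI[OF IntI[OF Suc.prems(2) V(2)] W(2)]]
    by (elim exE conjE)
  note cs = bump_cont[OF f(1)] bump_cont[OF g(1)] bump_cont[OF F] bump_cont[OF H]
  have b1: "bump (real (Suc n)) d U (\<lambda>x. f x + F x)"
    using bump_add[OF f(1) bump_mono[OF F, of U]] by (auto simp: add.commute)
  have b2: "bump (real (Suc n)) d U (\<lambda>x. g x + H x)"
    using bump_add[OF bump_mono[OF g(1), of U] bump_mono[OF H, of U]] by (auto simp: add.commute)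
  \<comment> \<open>On \<open>V \<inter> W\<close> both \<open>f\<close> and \<open>g\<close> are 1
    and cancel; off it \<open>F\<close> and \<open>H\<close> vanish, and \<open>f - g\<close> is
    nonnegative because \<open>g\<close> lives where \<open>f\<close> is 1.\<close>
  have alt: "0 \<le> (f x + F x) - (g x + H x) \<and> (f x + F x) - (g x + H x) \<le> 1" for x
  proof (cases "x \<in> V \<inter> W")
    case True
    then show ?thesis
      using V(3) W(3) spec[OF FH, of x] by auto
  next
    case False
    then have "F x = 0" "H x = 0"
      using bump_off[OF F, of x] bump_off[OF H, of x] by auto
    moreover have "0 \<le> f x - g x"
      using V(3) bump_off[OF g(1), of x] bump_le[OF g(1), of x] bump_ge0[OF f(1), of x]
      by (cases "x \<in> V") auto
    moreover have "f x - g x \<le> 1"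
      using bump_le[OF f(1), of x] bump_ge0[OF g(1), of x] by simp
    ultimately show ?thesis
      by simp
  qed
  have "norm (S (\<lambda>x. f x + F x) y) \<le> real (Suc n) * \<rho>" if "y \<in> A" for y
    using bspec[OF f(2) that] bspec[OF FA that] norm_triangle_ineq[of "S f y" "S F y"] cs
    by (simp add: S_add algebra_simps)
  moreover have "norm (S (\<lambda>x. g x + H x) y) \<le> real (Suc n) * \<rho>" if "y \<in> B" for y
    using bspec[OF g(2) that] bspec[OF HB that] norm_triangle_ineq[of "S g y" "S H y"] cs
    by (simp add: S_add algebra_simps)
  ultimately show ?case
    using b1 b2 alt
    by - (rule exI[of _ "\<lambda>x. f x + F x"], rule exI[of _ "\<lambda>x. g x + H x"], simp)
qed

text \<open>The images of \<open>F\<close> and \<open>H\<close> differ by at most \<open>M\<close>,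
  so at each point of the union the one known to be small controls \<open>F + H\<close> up to an
  error \<open>M\<close>. Dividing by the height \<open>n + n\<close> makes that error
  small.\<close>

lemma negligible_at_Un:
  assumes A: "negligible_at d A" and B: "negligible_at d B"
  shows "negligible_at d (A \<union> B)"
  unfolding negligible_at_def
proof (intro allI impI, elim conjE)
  fix U \<rho> assume U: "open U" "d \<in> U" and "3 * \<eta> < \<rho>"
  then obtain \<rho>' where \<rho>': "3 * \<eta> < \<rho>'" "\<rho>' < \<rho>"
    using dense by blast
  obtain n :: nat where n: "0 < n" "real n * \<rho>' + M < real n * \<rho>"
    by (rule archimedean_average[OF \<rho>'(2)])
  obtain F H where F: "bump (real n) d U F" and H: "bump (real n) d U H"
    and FH: "\<forall>x. 0 \<le> F x - H x \<and> F x - H x \<le> 1"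
    and FA: "\<forall>y\<in>A. norm (S F y) \<le> real n * \<rho>'"
    and HB: "\<forall>y\<in>B. norm (S H y) \<le> real n * \<rho>'"
    using alternating_bumps[OF A B \<rho>'(1) U, of n] by (elim exE conjE)
  note cs = bump_cont[OF F] bump_cont[OF H]
  let ?f = "\<lambda>x. (1 / (real n + real n)) * (F x + H x)"
  have "unit_fun (\<lambda>x. F x - H x)"
    using FH cs by (auto simp: unit_fun_def abs_le_iff intro!: continuous_intros)
  then have diff: "norm (S F y - S H y) \<le> M" for y
    using bound S_diff[OF cs] by metis
  have "norm (S ?f y) < \<rho>" if "y \<in> A \<union> B" for y
  proof -
    have "norm (S F y + S H y) \<le> 2 * (real n * \<rho>') + M"
    proof (cases "y \<in> A")
      case True
      have "norm (S F y + S H y) = norm (2 *\<^sub>R S F y - (S F y - S H y))"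
        by (simp add: scaleR_2)
      also have "\<dots> \<le> 2 * norm (S F y) + norm (S F y - S H y)"
        using norm_triangle_ineq4[of "2 *\<^sub>R S F y" "S F y - S H y"] by simp
      finally show ?thesis
        using bspec[OF FA True] diff[of y] by simp
    next
      case False
      then have "y \<in> B"
        using that by simp
      have "norm (S F y + S H y) = norm (2 *\<^sub>R S H y + (S F y - S H y))"
        by (simp add: scaleR_2 add.commute)
      also have "\<dots> \<le> 2 * norm (S H y) + norm (S F y - S H y)"
        using norm_triangle_ineq[of "2 *\<^sub>R S H y" "S F y - S H y"] by simp
      finally show ?thesis
        using bspec[OF HB \<open>y \<in> B\<close>] diff[of y] by simp
    qed
    also have "\<dots> < 2 * (real n * \<rho>)"
      using n(2) M_nonneg by simp
    finally have "norm (S F y + S H y) < (real n + real n) * \<rho>"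
      by simp
    moreover have "S ?f y = (1 / (real n + real n)) *\<^sub>R (S F y + S H y)"
      unfolding S_add[OF cs, symmetric] by (intro S_scale continuous_intros cs)
    ultimately show ?thesis
      using n(1) by (simp add: divide_simps mult.commute)
  qed
  moreover have "bump 1 d U ?f"
    using bump_scale[OF bump_add[OF F H]] n(1) by simp
  ultimately show "\<exists>f. bump 1 d U f \<and> (\<forall>y\<in>A \<union> B. norm (S f y) < \<rho>)"
    by blast
qed

lemma negligible_at_Union:
  assumes "finite I" and "\<And>i. i \<in> I \<Longrightarrow> negligible_at d (A i)"
  shows "negligible_at d (\<Union>i\<in>I. A i)"
  using assms by (induction I) (auto simp: negligible_at_empty negligible_at_Un)

text \<open>Each new bump is chosen small on the exceptional set \<open>Q\<close> of its
  predecessors, and \<open>Q\<close> then absorbs the points where the new image reaches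
  \<open>3 * \<eta>\<close>. So at any point of \<open>P\<close> at most one summand exceeds
  \<open>\<rho>\<close>, and that one costs at most \<open>M\<close>.\<close>

lemma sequential_bumps:
  assumes P: "\<forall>f. bump 1 d U0 f \<longrightarrow> negligible_at d {y\<in>P. 3 * \<eta> \<le> norm (S f y)}"
    and \<rho>: "3 * \<eta> < \<rho>" and U: "open U" "d \<in> U" "U \<subseteq> U0"
  shows "\<exists>F Q. bump (real n) d U F \<and> negligible_at d Q \<and>
    (\<forall>y\<in>P - Q. norm (S F y) \<le> real n * \<rho>) \<and> (\<forall>y\<in>P. norm (S F y) \<le> real n * \<rho> + M)"
proof (induction n)
  case 0
  show ?case
    using M_nonneg
    by (intro exI[of _ "\<lambda>x. 0"] exI[of _ "{}"])
      (auto simp: bump_def S_zero negligible_at_empty)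
next
  case (Suc n)
  then obtain F Q where F: "bump (real n) d U F" and Q: "negligible_at d Q"
    and PQ: "\<forall>y\<in>P - Q. norm (S F y) \<le> real n * \<rho>"
    and PM: "\<forall>y\<in>P. norm (S F y) \<le> real n * \<rho> + M"
    by (elim exE conjE)
  obtain f where f: "bump 1 d U f" "\<forall>y\<in>Q. norm (S f y) < \<rho>"
    by (rule negligible_atD[OF Q U(1,2) \<rho>])
  let ?B = "{y\<in>P. 3 * \<eta> \<le> norm (S f y)}"
  have Q': "negligible_at d (Q \<union> ?B)"
    using P[rule_format, OF bump_mono[OF f(1) U(3)]] Q by (rule negligible_at_Un[rotated])
  have b: "bump (real (Suc n)) d U (\<lambda>x. f x + F x)"
    using bump_add[OF f(1) F] by (simp add: add.commute)
  have tri: "norm (S (\<lambda>x. f x + F x) y) \<le> norm (S f y) + norm (S F y)" for y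
    using bump_cont[OF f(1)] bump_cont[OF F] by (simp add: S_add norm_triangle_ineq)
  have "norm (S (\<lambda>x. f x + F x) y) \<le> real (Suc n) * \<rho>" if "y \<in> P - (Q \<union> ?B)" for y
    using tri[of y] bspec[OF PQ, of y] that \<rho> by (auto simp: algebra_simps)
  moreover have "norm (S (\<lambda>x. f x + F x) y) \<le> real (Suc n) * \<rho> + M" if "y \<in> P" for y
  proof (cases "y \<in> Q")
    case True
    then show ?thesis
      using tri[of y] bspec[OF PM that] bspec[OF f(2) True] by (simp add: algebra_simps)
  next
    case False
    then show ?thesis
      using tri[of y] bspec[OF PQ, of y] that bound[OF bump_unit_fun[OF f(1)], of y] eta_pos \<rho>
      by (auto simp: algebra_simps)
  qed
  ultimately show ?case
    using b Q' by (intro exI[of _ "\<lambda>x. f x + F x"] exI[of _ "Q \<union> ?B"] conjI ballI) simp_all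
qed

text \<open>If all these level sets were negligible, the mean of \<open>n\<close> bumps from
  \<open>sequential_bumps\<close> would have image at most \<open>\<rho>' + M / n\<close> on
  \<open>P\<close>, making \<open>P\<close> itself negligible.\<close>

lemma not_negligible_at_level:
  assumes P: "\<not> negligible_at d P" and U0: "open U0" "d \<in> U0"
  shows "\<exists>f. bump 1 d U0 f \<and> \<not> negligible_at d {y\<in>P. 3 * \<eta> \<le> norm (S f y)}"
proof (rule ccontr)
  assume "\<not> ?thesis"
  then have *: "\<forall>f. bump 1 d U0 f \<longrightarrow> negligible_at d {y\<in>P. 3 * \<eta> \<le> norm (S f y)}"
    by simp
  have "negligible_at d P"
    unfolding negligible_at_def
  proof (intro allI impI, elim conjE)
    fix U \<rho> assume U: "open U" "d \<in> U" and "3 * \<eta> < \<rho>"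
    then obtain \<rho>' where \<rho>': "3 * \<eta> < \<rho>'" "\<rho>' < \<rho>"
      using dense by blast
    obtain n :: nat where n: "0 < n" "real n * \<rho>' + M < real n * \<rho>"
      by (rule archimedean_average[OF \<rho>'(2)])
    obtain F where F: "bump (real n) d (U \<inter> U0) F"
      and FP: "\<forall>y\<in>P. norm (S F y) \<le> real n * \<rho>' + M"
      using sequential_bumps[OF * \<rho>'(1) open_Int[OF U(1) U0(1)] IntI[OF U(2) U0(2)] Int_lower2, of n]
      by (elim exE conjE)
    have "bump 1 d U (\<lambda>x. (1 / real n) * F x)"
      using bump_mono[OF bump_scale[OF F], of U] n(1) by simp
    moreover have "norm (S (\<lambda>x. (1 / real n) * F x) y) < \<rho>" if "y \<in> P" for y
    proof -
      have "S (\<lambda>x. (1 / real n) * F x) y = (1 / real n) *\<^sub>R S F y"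
        by (rule S_scale[OF bump_cont[OF F]])
      then show ?thesis
        using bspec[OF FP that] n by (simp add: divide_simps mult.commute)
    qed
    ultimately show "\<exists>f. bump 1 d U f \<and> (\<forall>y\<in>P. norm (S f y) < \<rho>)"
      by blast
  qed
  with P show False ..
qed

text \<open>
  If no point of the codomain has an atom at \<open>d\<close>, the part of a function close to \<open>d\<close> can be cut
  off locally, which makes room for further disjoint functions still closer to \<open>d\<close>.
\<close>

lemma packed_of_no_atom:
  assumes no_atom: "\<forall>y. \<exists>U. open U \<and> d \<in> U \<and>
      \<not> (\<exists>f. unit_fun f \<and> (\<forall>x. x \<notin> U \<longrightarrow> f x = 0) \<and> \<eta> < norm (S f y))"
    and "\<not> negligible_at d P" and "closed P" and "open U" and "d \<in> U"
  shows "\<exists>y\<in>P. packed S \<eta> n U y"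
  using assms(2-)
proof (induction n arbitrary: P U)
  case 0
  then have "P \<noteq> {}"
    using negligible_at_empty by auto
  then show ?case
    by auto
next
  case (Suc n)
  obtain f where f: "bump 1 d U f" "\<not> negligible_at d {y\<in>P. 3 * \<eta> \<le> norm (S f y)}"
    using not_negligible_at_level[OF Suc.prems(1,3,4)] by (elim exE conjE)
  let ?B = "{y\<in>P. 3 * \<eta> \<le> norm (S f y)}"
  note cf = bump_cont[OF f(1)]
  have "closed ?B"
    using closed_Int[OF Suc.prems(2) closed_level[OF cf]] by (simp add: Int_def)
  then have "compact ?B"
    using compact_Int_closed[OF compact_cod] by simp
  \<comment> \<open>\<open>h g\<close> is \<open>f\<close> with its part near \<open>d\<close> cut
    off: it vanishes on the plateau of \<open>g\<close>.\<close>
  define h where "h g x = f x * (1 - g x)" for g :: "'a \<Rightarrow> real" and x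
  have hcont: "continuous_on UNIV (h g)" if "bump 1 d W g" for g W
    unfolding h_def using bump_cont[OF that] cf by (intro continuous_intros)
  \<comment> \<open>The removed part \<open>f * g\<close> is supported in \<open>W\<close>, where
    its image at \<open>y\<close> is at most \<open>\<eta>\<close>; of the original
    \<open>3 * \<eta>\<close> at least \<open>2 * \<eta>\<close> remains.\<close>
  have cut: "\<exists>g. bump 1 d UNIV g \<and> 2 * \<eta> \<le> norm (S (h g) y)" if "y \<in> ?B" for y
  proof -
    obtain W where W: "open W" "d \<in> W"
      "\<not> (\<exists>f. unit_fun f \<and> (\<forall>x. x \<notin> W \<longrightarrow> f x = 0) \<and> \<eta> < norm (S f y))"
      using spec[OF no_atom, of y] by (elim exE conjE)
    obtain g where g: "bump 1 d W g"
      using bump_exists[OF compact_dom W(1,2)] by (elim exE)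
    have unit: "unit_fun (\<lambda>x. f x * g x)"
      using bump_unit_fun[OF f(1)] bump_unit_fun[OF g]
      by (auto simp: unit_fun_def abs_mult intro!: continuous_intros mult_le_one)
    have "norm (S (\<lambda>x. f x * g x) y) \<le> \<eta>"
    proof (rule leI, rule notI)
      assume "\<eta> < norm (S (\<lambda>x. f x * g x) y)"
      with unit have "\<exists>f. unit_fun f \<and> (\<forall>x. x \<notin> W \<longrightarrow> f x = 0) \<and> \<eta> < norm (S f y)"
        using bump_off[OF g] by (intro exI[of _ "\<lambda>x. f x * g x"]) simp
      with W(3) show False ..
    qed
    moreover have "S (h g) y = S f y - S (\<lambda>x. f x * g x) y"
      using S_diff[of f "\<lambda>x. f x * g x" y] cf bump_cont[OF g]
      by (simp add: h_def[abs_def] algebra_simps continuous_on_mult)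
    ultimately have "2 * \<eta> \<le> norm (S (h g) y)"
      using that norm_triangle_ineq2[of "S f y" "S (\<lambda>x. f x * g x) y"] by simp
    with bump_mono[OF g] show ?thesis
      by (intro exI[of _ g]) simp
  qed
  have "\<forall>y\<in>?B. \<exists>g. bump 1 d UNIV g \<and> 2 * \<eta> \<le> norm (S (h g) y)"
    by (intro ballI cut)
  from bchoice[OF this] obtain g
    where g: "\<forall>y\<in>?B. bump 1 d UNIV (g y) \<and> 2 * \<eta> \<le> norm (S (h (g y)) y)"
    by (elim exE)
  \<comment> \<open>The level \<open>3 / 2 * \<eta>\<close> is below \<open>2 * \<eta>\<close>, so
    the open sets cover \<open>?B\<close>, and above \<open>\<eta>\<close>, so the closed version
    \<open>?P z\<close> used for the induction still exceeds \<open>\<eta>\<close>.\<close>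
  define G where "G z = {y. 3 / 2 * \<eta> < norm (S (h (g z)) y)}" for z
  obtain T where T: "T \<subseteq> ?B" "finite T" "?B \<subseteq> (\<Union>z\<in>T. G z)"
  proof (rule compactE_image[OF \<open>compact ?B\<close>, of ?B G])
    show "open (G z)" if "z \<in> ?B" for z
      unfolding G_def using bspec[OF g that] by (intro open_level hcont[where W = UNIV]) simp
    have "y \<in> G y" if "y \<in> ?B" for y
      unfolding G_def using bspec[OF g that] eta_pos by simp
    then show "?B \<subseteq> (\<Union>z\<in>?B. G z)"
      by blast
  qed
  let ?P = "\<lambda>z. ?B \<inter> {y. 3 / 2 * \<eta> \<le> norm (S (h (g z)) y)}"
  have sub: "?B \<subseteq> (\<Union>z\<in>T. ?P z)"
    using T(3) unfolding G_def by (force simp: less_imp_le)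
  have "\<not> negligible_at d (\<Union>z\<in>T. ?P z)"
    using f(2) negligible_at_mono[OF _ sub] by (rule contrapos_nn)
  then obtain z where z: "z \<in> T" "\<not> negligible_at d (?P z)"
    using negligible_at_Union[OF T(2), of d ?P] by blast
  have gz: "bump 1 d UNIV (g z)"
    using bspec[OF g subsetD[OF T(1) z(1)]] by simp
  obtain V where V: "open V" "d \<in> V" "\<forall>x\<in>V. g z x = 1"
    by (rule bump_nbhd[OF gz])
  have cP: "closed (?P z)"
    by (intro closed_Int \<open>closed ?B\<close> closed_level hcont[OF gz])
  \<comment> \<open>The other \<open>n\<close> functions are sought inside the plateau
    \<open>V\<close>, where \<open>h (g z)\<close> is 0, at a point where its image is still
    large.\<close>
  obtain y where y: "y \<in> ?P z" "packed S \<eta> n (U \<inter> V) y"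
    using Suc.IH[OF z(2) cP open_Int[OF Suc.prems(3) V(1)] IntI[OF Suc.prems(4) V(2)]] by (elim bexE)
  have "unit_fun (h (g z))"
    unfolding unit_fun_def
  proof (intro conjI allI)
    show "\<bar>h (g z) x\<bar> \<le> 1" for x
      using bump_ge0[OF f(1), of x] bump_le[OF f(1), of x] bump_ge0[OF gz, of x] bump_le[OF gz, of x]
      by (auto simp: h_def abs_mult intro!: mult_le_one)
  qed (rule hcont[OF gz])
  moreover have "h (g z) x = 0" if "x \<notin> U - V" for x
    using that V(3) bump_off[OF f(1), of x] by (auto simp: h_def)
  moreover have "\<eta> < norm (S (h (g z)) y)"
    using y(1) eta_pos by simp
  moreover have "packed S \<eta> n (U - (U - V)) y"
    using y(2) by (simp add: Diff_Diff_Int)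
  ultimately have "packed S \<eta> (Suc n) U y"
    unfolding packed.simps by (intro exI[of _ "U - V"] exI[of _ "h (g z)"] conjI) auto
  then show ?case
    using y(1) by (intro bexI[of _ y]) simp_all
qed

text \<open>Otherwise \<open>packed_of_no_atom\<close>, started from the whole codomain, would yield
  the \<open>Suc N\<close> functions that \<open>not_packed\<close> excludes.\<close>

lemma atom_exists:
  "\<exists>y. \<forall>U. open U \<and> d \<in> U \<longrightarrow>
     (\<exists>f. unit_fun f \<and> (\<forall>x. x \<notin> U \<longrightarrow> f x = 0) \<and> \<eta> < norm (S f y))"
proof (rule ccontr)
  assume "\<not> ?thesis"
  then have "\<forall>y. \<exists>U. open U \<and> d \<in> U \<and>
      \<not> (\<exists>f. unit_fun f \<and> (\<forall>x. x \<notin> U \<longrightarrow> f x = 0) \<and> \<eta> < norm (S f y))"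
    by (simp only: not_all not_ex not_imp conj_assoc simp_thms)
  from packed_of_no_atom[OF this not_negligible_at_UNIV closed_UNIV open_UNIV UNIV_I, of "Suc N"]
  show False
    using not_packed by (elim bexE) (rule notE)
qed

end

section \<open>Derivatives of the family of atoms and cardinality\<close>

lemma finite_card_of_ordLeq:
  assumes "finite A" and "infinite (Field r)" and "Card_order r"
  shows "|A| \<le>o r"
  using assms by (intro ordLess_imp_ordLeq finite_ordLess_infinite)
    (simp_all add: Field_card_of card_of_well_order_on card_order_on_well_order_on)

locale disjointly_bounded_atoms = disjointly_bounded S M \<eta> N
  for S :: "('a::t2_space \<Rightarrow> real) \<Rightarrow> 'b::t2_space \<Rightarrow> 'e::real_normed_vector"
    and M \<eta> :: real and N :: nat +
  fixes D :: "'a set" and p :: "'a \<Rightarrow> 'b"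
  assumes discrete_D: "discrete D"
    and atom: "\<lbrakk>open U; d \<in> U\<rbrakk> \<Longrightarrow>
      \<exists>f. unit_fun f \<and> (\<forall>x. x \<notin> U \<longrightarrow> f x = 0) \<and> \<eta> < norm (S f (p d))"
begin

text \<open>Cantor-Bendixson derivatives of the indexed family \<open>p\<close>, counting repeated points.\<close>

fun derived :: "nat \<Rightarrow> 'a set" where
  "derived 0 = D"
| "derived (Suc k) =
     {d \<in> derived k. \<forall>G. open G \<and> p d \<in> G \<longrightarrow> infinite {e \<in> derived k. p e \<in> G}}"

lemma derived_subset: "derived k \<subseteq> D"
  by (induction k) auto

text \<open>The open set is to contain a support; the closed one is removed afterwards, leaving an
  open set that still contains the rest of \<open>D\<close>.\<close>

lemma isolating_closed_nbhd:
  assumes "d \<in> D"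
  shows "\<exists>O' C. open O' \<and> closed C \<and> d \<in> O' \<and> O' \<subseteq> C \<and> C \<inter> D = {d}"
proof -
  obtain U where U: "open U" "U \<inter> D = {d}"
    using discreteD[OF discrete_D assms] by (auto simp: isolated_in_def)
  then have "d \<in> U"
    by blast
  obtain f where f: "bump 1 d U f"
    using bump_exists[OF compact_dom U(1) \<open>d \<in> U\<close>] by (elim exE)
  have "{x. 1 / 2 \<le> f x} \<subseteq> U"
    using bump_off[OF f] by force
  then have "{x. 1 / 2 \<le> f x} \<inter> D = {d}"
    using U(2) bump_centre[OF f] by auto
  moreover have "open {x. 1 / 2 < f x}" "closed {x. 1 / 2 \<le> f x}"
    using bump_cont[OF f] by (auto intro!: open_Collect_less closed_Collect_le continuous_intros)
  moreover have "d \<in> {x. 1 / 2 < f x}"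
    using bump_centre[OF f] by simp
  moreover have "{x. 1 / 2 < f x} \<subseteq> {x. 1 / 2 \<le> f x}"
    by auto
  ultimately show ?thesis
    by - (rule exI[of _ "{x. 1 / 2 < f x}"], rule exI[of _ "{x. 1 / 2 \<le> f x}"], intro conjI)
qed

text \<open>One function is spent at \<open>d\<close>, and each derivative allows a move to a nearby
  \<open>p e\<close> for another one, so \<open>k\<close> derivatives give \<open>Suc k\<close>
  functions. \<open>F\<close> records the points already used.\<close>

lemma packed_of_derived:
  assumes C: "\<And>d. d \<in> D \<Longrightarrow> open (I d) \<and> closed (C d) \<and> d \<in> I d \<and> I d \<subseteq> C d \<and> C d \<inter> D = {d}"
    and "d \<in> derived k" and "finite F" and "F \<subseteq> D" and "d \<notin> F" and "open G" and "p d \<in> G"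
  shows "\<exists>w\<in>G. packed S \<eta> (Suc k) (- (\<Union>e\<in>F. C e)) w"
proof -
  have C_open: "open (- (\<Union>e\<in>F. C e))" if "finite F" "F \<subseteq> D" for F
    using that C by (intro open_Compl closed_UN) auto
  have C_notin: "d \<in> - (\<Union>e\<in>F. C e)" if d: "d \<in> D" and F: "F \<subseteq> D" "d \<notin> F" for d F
  proof (rule ComplI, elim UN_E)
    fix e assume e: "e \<in> F" "d \<in> C e"
    then have "d \<in> C e \<inter> D"
      using d by simp
    then show False
      using C[OF subsetD[OF F(1) e(1)]] F(2) e(1) by auto
  qed
  show ?thesis
    using assms(2-)
  proof (induction k arbitrary: d F G)
    case (0 d F G)
    let ?A = "- (\<Union>e\<in>F. C e)"
    have "open ?A" "d \<in> ?A"
      using C_open[OF 0(2,3)] C_notin[OF _ 0(3,4)] 0(1) by simp_all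
    from atom[OF this] obtain f where f: "unit_fun f" "\<forall>x. x \<notin> ?A \<longrightarrow> f x = 0"
      "\<eta> < norm (S f (p d))"
      by (elim exE conjE)
    have "packed S \<eta> (Suc 0) ?A (p d)"
      unfolding packed.simps
      by (rule exI[of _ ?A], rule exI[of _ f], intro conjI f order_refl TrueI)
    then show ?case
      using 0(6) by (intro bexI[of _ "p d"])
  next
    case (Suc k d F G)
    have d: "d \<in> derived k"
      and lim: "\<forall>G. open G \<and> p d \<in> G \<longrightarrow> infinite {e \<in> derived k. p e \<in> G}"
      using Suc.prems(1) by simp_all
    have dD: "d \<in> D"
      by (rule subsetD[OF derived_subset d])
    let ?A = "- (\<Union>e\<in>F. C e)"
    have A1: "open (?A \<inter> I d)"
      using C[OF dD] C_open[OF Suc.prems(2,3)] by (intro open_Int) simp_all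
    have A2: "d \<in> ?A \<inter> I d"
      using C[OF dD] C_notin[OF dD Suc.prems(3,4)] by simp
    obtain f where f: "unit_fun f" "\<forall>x. x \<notin> ?A \<inter> I d \<longrightarrow> f x = 0"
      "\<eta> < norm (S f (p d))"
      using atom[OF A1 A2] by (elim exE conjE)
    \<comment> \<open>The level set of \<open>f\<close> is open, so the point \<open>w\<close> found
      later inside \<open>?G\<close> still sees a large image of \<open>f\<close>.\<close>
    let ?G = "G \<inter> {y. \<eta> < norm (S f y)}"
    have G: "open ?G" "p d \<in> ?G"
      using f Suc.prems(5,6) open_level by (auto simp: unit_fun_def)
    have "infinite {e \<in> derived k. p e \<in> ?G}"
      by (rule mp[OF spec[OF lim] conjI[OF G]])
    then have "\<not> {e \<in> derived k. p e \<in> ?G} \<subseteq> insert d F"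
      using Suc.prems(2) by (meson finite_insert finite_subset)
    then obtain e where e: "e \<in> derived k" "p e \<in> ?G" "e \<notin> insert d F"
      unfolding subset_iff mem_Collect_eq not_all not_imp by (elim exE conjE)
    obtain w where w: "w \<in> ?G" "packed S \<eta> (Suc k) (- (\<Union>e\<in>insert d F. C e)) w"
      using Suc.IH[OF e(1) finite.insertI[OF Suc.prems(2)] insert_subsetI[OF dD Suc.prems(3)] e(3) G(1) e(2)]
      by (elim bexE)
    have "- (\<Union>e\<in>insert d F. C e) \<subseteq> ?A - (?A \<inter> I d)"
      using C[OF dD] by auto
    then have "packed S \<eta> (Suc k) (?A - (?A \<inter> I d)) w"
      using packed_mono[OF w(2)] by simp
    moreover have "\<eta> < norm (S f w)"
      using w(1) by simp
    ultimately have "packed S \<eta> (Suc (Suc k)) ?A w"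
      unfolding packed.simps(2)[of _ _ "Suc k"] using f(1,2)
      by - (rule exI[of _ "?A \<inter> I d"], rule exI[of _ f], intro conjI Int_lower1)
    moreover have "w \<in> G"
      using w(1) by simp
    ultimately show ?case
      by (rule bexI)
  qed
qed

text \<open>An index surviving \<open>N\<close> derivatives would produce \<open>Suc N\<close>
  disjointly supported functions.\<close>

lemma derived_empty: "derived N = {}"
proof (rule equals0I)
  fix d assume d: "d \<in> derived N"
  have "\<forall>d\<in>D. \<exists>O' C. open O' \<and> closed C \<and> d \<in> O' \<and> O' \<subseteq> C \<and> C \<inter> D = {d}"
    using isolating_closed_nbhd by blast
  then obtain I C where
    "\<And>d. d \<in> D \<Longrightarrow> open (I d) \<and> closed (C d) \<and> d \<in> I d \<and> I d \<subseteq> C d \<and> C d \<inter> D = {d}"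
    by metis
  from packed_of_derived[OF this d, of "{}" UNIV] show False
    using not_packed by auto
qed

definition layer :: "nat \<Rightarrow> 'a set" where
  "layer k = derived k - derived (Suc k)"

lemma D_eq_layers: "D = (\<Union>k<N. layer k)"
proof -
  have "D \<subseteq> (\<Union>k<n. layer k) \<union> derived n" for n
  proof (induction n)
    case (Suc n)
    then show ?case
      unfolding layer_def lessThan_Suc by blast
  qed simp
  from this[of N] show ?thesis
    using derived_empty derived_subset unfolding layer_def by auto
qed

lemma layer_nbhd:
  assumes "d \<in> layer k"
  obtains G where "open G" and "p d \<in> G" and "finite {e \<in> layer k. p e \<in> G}"
proof -
  obtain G where "open G" "p d \<in> G" "finite {e \<in> derived k. p e \<in> G}"
    using assms unfolding layer_def by auto
  moreover have "{e \<in> layer k. p e \<in> G} \<subseteq> {e \<in> derived k. p e \<in> G}"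
    by (auto simp: layer_def)
  ultimately show ?thesis
    using that finite_subset by blast
qed

text \<open>A neighbourhood meeting the image in finitely many points stays open when the other
  points, a closed finite set, are deleted.\<close>

lemma discrete_layer: "discrete (p ` layer k)"
proof (rule discreteI)
  fix z assume "z \<in> p ` layer k"
  then obtain d where d: "d \<in> layer k" "z = p d"
    by blast
  obtain G where G: "open G" "p d \<in> G" "finite {e \<in> layer k. p e \<in> G}"
    using layer_nbhd[OF d(1)] by blast
  have "G \<inter> p ` layer k = p ` {e \<in> layer k. p e \<in> G}"
    by auto
  then have fin: "finite (G \<inter> p ` layer k - {z})"
    using G(3) by simp
  have "open (G - (G \<inter> p ` layer k - {z}))"
    using G(1) finite_imp_closed[OF fin] by (rule open_Diff)
  moreover have "(G - (G \<inter> p ` layer k - {z})) \<inter> p ` layer k = {z}"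
    using d G(2) by auto
  ultimately show "z isolated_in p ` layer k"
    using d by (auto simp: isolated_in_def)
qed

text \<open>The neighbourhoods of \<open>layer_nbhd\<close> make the fibres of \<open>p\<close>
  finite, and an infinite image absorbs finite fibres.\<close>

lemma layer_card_le:
  assumes "infinite (layer k)"
  shows "infinite (p ` layer k)" and "|layer k| \<le>o |p ` layer k|"
proof -
  let ?A = "\<lambda>z. {e \<in> layer k. p e = z}"
  have fibre: "finite (?A z)" if z: "z \<in> p ` layer k" for z
  proof -
    obtain d where d: "d \<in> layer k" "z = p d"
      using z by blast
    obtain G where "p d \<in> G" "finite {e \<in> layer k. p e \<in> G}"
      using layer_nbhd[OF d(1)] by blast
    then show ?thesis
      using d(2) by (auto elim!: finite_subset[rotated])
  qed
  have eq: "layer k = (\<Union>z\<in>p ` layer k. ?A z)"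
    by auto
  show inf: "infinite (p ` layer k)"
    using assms fibre eq by (metis (no_types, lifting) finite_UN_I)
  have "|\<Union>z\<in>p ` layer k. ?A z| \<le>o |p ` layer k|"
    using fibre finite_card_of_ordLeq[OF _ _ card_of_Card_order] inf
    by (intro card_of_UNION_ordLeq_infinite[OF inf]) (auto simp: Field_card_of card_of_refl ordIso_imp_ordLeq)
  then show "|layer k| \<le>o |p ` layer k|"
    using eq by simp
qed

lemma infinite_le_spread:
  assumes "infinite D"
  shows "infinite (Field (spread (UNIV :: 'b set)))" and "|D| \<le>o spread (UNIV :: 'b set)"
proof -
  have *: "|layer k| \<le>o spread (UNIV :: 'b set)" if "infinite (layer k)" for k
    using ordLeq_transitive[OF layer_card_le(2)[OF that]
        card_of_discrete_le_spread[OF subset_UNIV discrete_layer]] .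
  \<comment> \<open>One of the finitely many layers is infinite; it makes the spread infinite, after
    which finite layers are dominated as well.\<close>
  obtain k where k: "infinite (layer k)"
    using assms D_eq_layers by (metis finite_UN_I finite_lessThan)
  have "|layer k| \<le>o |Field (spread (UNIV :: 'b set))|"
    using *[OF k] ordIso_symmetric[OF card_of_Field_ordIso[OF Card_order_spread]]
    by (rule ordLeq_ordIso_trans)
  from card_of_ordLeq_infinite[OF this k]
  show inf: "infinite (Field (spread (UNIV :: 'b set)))" .
  have "|layer k| \<le>o spread (UNIV :: 'b set)" for k
    using * finite_card_of_ordLeq[OF _ inf Card_order_spread] by (cases "finite (layer k)")
  then have "|\<Union>k\<in>{..<N}. layer k| \<le>o spread (UNIV :: 'b set)"
    using finite_card_of_ordLeq[OF finite_lessThan inf Card_order_spread]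
    by (intro card_of_UNION_ordLeq_infinite_Field[OF inf Card_order_spread] ballI)
  then show "|D| \<le>o spread (UNIV :: 'b set)"
    using D_eq_layers by simp
qed

end

section \<open>Cotype\<close>

lemma abs_rademacher_le: "\<bar>rademacher i t\<bar> \<le> 1"
  by (simp add: rademacher_def abs_sgn_eq)

lemma abs_sum_disjoint_le:
  fixes f :: "'i \<Rightarrow> real"
  assumes "finite I" and "\<And>i j. \<lbrakk>i \<in> I; j \<in> I; i \<noteq> j\<rbrakk> \<Longrightarrow> f i = 0 \<or> f j = 0"
    and "\<And>i. i \<in> I \<Longrightarrow> \<bar>f i\<bar> \<le> 1"
  shows "\<bar>sum f I\<bar> \<le> 1"
proof (cases "\<exists>i\<in>I. f i \<noteq> 0")
  case True
  then obtain i where i: "i \<in> I" "f i \<noteq> 0"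
    by blast
  have "sum f (I - {i}) = 0"
    using assms(2) i by (intro sum.neutral) auto
  then have "sum f I = f i"
    using sum.remove[OF assms(1) i(1), of f] by simp
  then show ?thesis
    using assms(3)[OF i(1)] by simp
qed simp

text \<open>Disjointly supported functions stay in the unit ball under any choice of signs, so every
  Rademacher sum of the images has norm at most \<open>M\<close>. Cotype then bounds the number
  \<open>n\<close> of images larger than \<open>\<eta>\<close> by
  \<open>(C * M / \<eta>) powr q\<close>.\<close>

lemma cotype_not_packed:
  fixes S :: "('a::t2_space \<Rightarrow> real) \<Rightarrow> 'b \<Rightarrow> 'e::real_normed_vector"
  assumes cotype: "nontrivial_cotype TYPE('e)"
    and lin: "\<And>f g a b y. \<lbrakk>continuous_on UNIV f; continuous_on UNIV g\<rbrakk> \<Longrightarrow>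
      S (\<lambda>x. a * f x + b * g x) y = a *\<^sub>R S f y + b *\<^sub>R S g y"
    and bound: "\<And>f y. unit_fun f \<Longrightarrow> norm (S f y) \<le> M"
    and \<eta>: "\<eta> > 0"
  shows "\<exists>N. \<forall>y. \<not> packed S \<eta> (Suc N) UNIV y"
proof -
  obtain q C :: real where q: "q \<ge> 2" and C: "C > 0" and qC: "\<forall>(n::nat) (e :: nat \<Rightarrow> 'e).
      (\<Sum>i=1..n. norm (e i) powr q) powr (1 / q)
        \<le> C * sqrt (integral {0..1} (\<lambda>t. (norm (\<Sum>i=1..n. rademacher i t *\<^sub>R e i))\<^sup>2))"
    using cotype unfolding nontrivial_cotype_def by (elim exE conjE)
  have sum: "S (\<lambda>x. \<Sum>i\<in>I. c i * f i x) y = (\<Sum>i\<in>I. c i *\<^sub>R S (f i) y)"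
    if "finite I" "\<And>i. i \<in> I \<Longrightarrow> continuous_on UNIV (f i)" for I :: "nat set" and c f y
    using that
  proof (induction I)
    case empty
    show ?case
      using lin[of "\<lambda>x. 0" "\<lambda>x. 0" 0 0 y] by simp
  next
    case (insert i I)
    have "continuous_on UNIV (\<lambda>x. \<Sum>i\<in>I. c i * f i x)"
      using insert.prems by (intro continuous_intros) auto
    then show ?case
      using lin[of "f i" "\<lambda>x. \<Sum>i\<in>I. c i * f i x" "c i" 1 y] insert by simp
  qed
  have M: "0 \<le> M"
    by (rule order_trans[OF norm_ge_zero bound[of "\<lambda>x. 0" undefined]]) (simp add: unit_fun_def)
  obtain N :: nat where N: "(C * M / \<eta>) powr q < real N"
    using reals_Archimedean2 by blast
  have "\<not> packed S \<eta> (Suc N) UNIV y" for y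
  proof
    define n where "n = Suc N"
    assume "packed S \<eta> (Suc N) UNIV y"
    from packed_family[OF this, folded n_def] obtain f where
      f: "\<forall>i\<in>{1..n}. unit_fun (f i) \<and> norm (S (f i) y) > \<eta> \<and> (\<forall>x. x \<notin> UNIV \<longrightarrow> f i x = 0)"
      and disj: "\<forall>x. \<forall>i\<in>{1..n}. \<forall>j\<in>{1..n}. i \<noteq> j \<longrightarrow> f i x = 0 \<or> f j x = 0"
      by (elim exE conjE)
    have cont: "continuous_on UNIV (f i)" and le1: "\<bar>f i x\<bar> \<le> 1" and big: "\<eta> \<le> norm (S (f i) y)"
      if "i \<in> {1..n}" for i x
      using bspec[OF f that] by (simp_all add: unit_fun_def)
    let ?g = "\<lambda>t. (norm (\<Sum>i=1..n. rademacher i t *\<^sub>R S (f i) y))\<^sup>2"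
    have g: "?g t \<le> M\<^sup>2" for t
    proof -
      have "unit_fun (\<lambda>x. \<Sum>i\<in>{1..n}. rademacher i t * f i x)"
        unfolding unit_fun_def
      proof (intro conjI allI)
        show "continuous_on UNIV (\<lambda>x. \<Sum>i\<in>{1..n}. rademacher i t * f i x)"
          by (intro continuous_intros cont)
        fix x
        show "\<bar>\<Sum>i\<in>{1..n}. rademacher i t * f i x\<bar> \<le> 1"
        proof (rule abs_sum_disjoint_le)
          fix i assume "i \<in> {1..n}"
          then show "\<bar>rademacher i t * f i x\<bar> \<le> 1"
            unfolding abs_mult using abs_rademacher_le le1 by (intro mult_le_one) simp_all
        next
          fix i j assume ij: "i \<in> {1..n}" "j \<in> {1..n}" "i \<noteq> j"
          have "f i x = 0 \<or> f j x = 0"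
            using bspec[OF bspec[OF spec[OF disj] ij(1)] ij(2)] ij(3) by (rule mp)
          then show "rademacher i t * f i x = 0 \<or> rademacher j t * f j x = 0"
            by auto
        qed simp
      qed
      from bound[OF this, of y] have "norm (\<Sum>i=1..n. rademacher i t *\<^sub>R S (f i) y) \<le> M"
        by (subst (asm) sum[OF finite_atLeastAtMost cont])
      then show ?thesis
        by (rule power_mono) simp
    qed
    have "integral {0..1} ?g \<le> M\<^sup>2"
    \<comment> \<open>The integral of a non-integrable function is 0 by default, which also obeys
      the bound.\<close>
    proof (cases "?g integrable_on {0..1}")
      case True
      then have "integral {0..1} ?g \<le> integral {0..1} (\<lambda>t::real. M\<^sup>2)"
        by (rule integral_le) (use g in auto)
      then show ?thesis
        by simp
    qed (simp add: not_integrable_integral)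
    then have "sqrt (integral {0..1} ?g) \<le> sqrt (M\<^sup>2)"
      by (rule real_sqrt_le_mono)
    then have "C * sqrt (integral {0..1} ?g) \<le> C * M"
      using C M by simp
    then have up: "(\<Sum>i=1..n. norm (S (f i) y) powr q) powr (1 / q) \<le> C * M"
      by (rule order_trans[OF spec[OF spec[OF qC, of n], of "\<lambda>i. S (f i) y"]])
    have "real n * \<eta> powr q = (\<Sum>i=1..n. \<eta> powr q)"
      by simp
    also have "\<dots> \<le> (\<Sum>i=1..n. norm (S (f i) y) powr q)"
      using big \<eta> q by (intro sum_mono powr_mono2) simp_all
    finally have "(real n * \<eta> powr q) powr (1 / q) \<le> (\<Sum>i=1..n. norm (S (f i) y) powr q) powr (1 / q)"
      using q by (intro powr_mono2) simp_all
    also note up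
    finally have "((real n * \<eta> powr q) powr (1 / q)) powr q \<le> (C * M) powr q"
      using q by (intro powr_mono2) simp_all
    then have "real n * \<eta> powr q \<le> (C * M) powr q"
      using q by (simp add: powr_powr)
    then have "real n \<le> (C * M / \<eta>) powr q"
      using \<eta> C M by (simp add: powr_divide pos_le_divide_eq)
    with N show False
      by (simp add: n_def)
  qed
  then show ?thesis
    by (intro exI[of _ N] allI)
qed

section \<open>From the embedding to the comparison of spreads\<close>

lemma compact_continuous_bcontfun:
  assumes "compact (UNIV :: 'a::topological_space set)" and "continuous_on UNIV (f :: 'a \<Rightarrow> real)"
  shows "f \<in> bcontfun"
  using assms compact_imp_bounded[OF compact_continuous_image[OF assms(2,1)]]
  by (simp add: bcontfun_def)

lemma isomorphic_embedding_disjointly_bounded: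
  fixes T :: "('a::t2_space \<Rightarrow>\<^sub>C real) \<Rightarrow> ('b::t2_space \<Rightarrow>\<^sub>C 'e::real_normed_vector)"
  assumes dom: "compact (UNIV :: 'a set)" and cod: "compact (UNIV :: 'b set)"
    and cotype: "nontrivial_cotype TYPE('e)"
    and T: "isomorphic_embedding T"
  shows "\<exists>M \<eta> N. disjointly_bounded (\<lambda>f. apply_bcontfun (T (Bcontfun f))) M \<eta> N"
proof -
  obtain R where bl: "bounded_linear T" and R: "homeomorphism UNIV (range T) T R"
    using T unfolding isomorphic_embedding_def by blast
  interpret T: bounded_linear T
    by (rule bl)
  obtain M where M: "M > 0" "\<And>f. norm (T f) \<le> norm f * M"
    using T.pos_bounded by blast
  have "continuous_on (range T) R"
    using R unfolding homeomorphism_def by blast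
  \<comment> \<open>Continuity of the inverse at the image of 0 with tolerance 1: images of norm
    below \<open>\<delta>\<close> come from functions of norm below 1.\<close>
  then have "\<exists>\<delta>>0. \<forall>z\<in>range T. dist z (T 0) < \<delta> \<longrightarrow> dist (R z) (R (T 0)) < 1"
    unfolding continuous_on_iff by (drule_tac bspec[OF _ rangeI[of T 0]]) (erule allE[of _ 1], simp)
  then obtain \<delta> where \<delta>: "\<delta> > 0" "\<forall>z\<in>range T. dist z (T 0) < \<delta> \<longrightarrow> dist (R z) (R (T 0)) < 1"
    by (elim exE conjE)
  have RT: "R (T f) = f" for f
    using R unfolding homeomorphism_def by auto
  define S where "S f = apply_bcontfun (T (Bcontfun f))" for f
  have apply_B: "apply_bcontfun (Bcontfun f) = f" if "continuous_on UNIV f" for f :: "'a \<Rightarrow> real"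
    using Bcontfun_inverse[OF compact_continuous_bcontfun[OF dom that]] .
  have lin: "S (\<lambda>x. a * f x + b * g x) y = a *\<^sub>R S f y + b *\<^sub>R S g y"
    if "continuous_on UNIV f" "continuous_on UNIV g" for f g a b y
  proof -
    have c: "continuous_on UNIV (\<lambda>x. a * f x + b * g x)"
      using that by (intro continuous_intros)
    have "Bcontfun (\<lambda>x. a * f x + b * g x) = a *\<^sub>R Bcontfun f + b *\<^sub>R Bcontfun g"
      by (rule bcontfun_eqI) (simp add: apply_B that c)
    then show ?thesis
      by (simp add: S_def T.add T.scaleR)
  qed
  have bound: "norm (S f y) \<le> M" if "unit_fun f" for f y
  proof -
    have "norm (Bcontfun f) \<le> 1"
      using that by (intro norm_bound) (simp add: apply_B unit_fun_def)
    then have "norm (T (Bcontfun f)) \<le> M"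
      using M(2)[of "Bcontfun f"] M(1) mult_right_mono[of "norm (Bcontfun f)" 1 M] by linarith
    then show ?thesis
      unfolding S_def by (rule order_trans[OF norm_bounded])
  qed
  \<comment> \<open>The choice \<open>\<eta> = \<delta> / 8\<close> makes \<open>4 * \<eta>\<close>
    half of \<open>\<delta>\<close>, so the inequality stays strict after passing to the supremum
    norm.\<close>
  have below: "\<exists>y. norm (S f y) \<ge> 4 * (\<delta> / 8)" if f: "continuous_on UNIV f" "f x = 1" for f x
  proof (rule ccontr)
    assume "\<not> ?thesis"
    then have "norm (S f y) \<le> \<delta> / 2" for y
      by (simp add: not_le less_imp_le)
    then have "norm (T (Bcontfun f)) \<le> \<delta> / 2"
      unfolding S_def by (rule norm_bound)
    then have "dist (T (Bcontfun f)) (T 0) < \<delta>"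
      using \<delta>(1) by (simp add: T.zero)
    from mp[OF bspec[OF \<delta>(2) rangeI] this] have "norm (Bcontfun f) < 1"
      unfolding RT by simp
    moreover have "norm (apply_bcontfun (Bcontfun f) x) \<le> norm (Bcontfun f)"
      by (rule norm_bounded)
    ultimately show False
      using f by (simp add: apply_B)
  qed
  have \<delta>8: "\<delta> / 8 > 0"
    using \<delta>(1) by simp
  have "\<exists>N. \<forall>y. \<not> packed S (\<delta> / 8) (Suc N) UNIV y"
    by (rule cotype_not_packed[where M = M]) (fact cotype lin bound \<delta>8)+
  then obtain N where N: "\<forall>y. \<not> packed S (\<delta> / 8) (Suc N) UNIV y"
    by (elim exE)
  have "disjointly_bounded S M (\<delta> / 8) N"
    unfolding disjointly_bounded_def
  proof (intro conjI allI impI)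
    show "continuous_on UNIV (S f)" for f
      by (simp add: S_def)
  qed (fact dom cod lin bound below \<delta>8 spec[OF N])+
  then show ?thesis
    unfolding S_def[abs_def] by (intro exI)
qed

theorem theorem1p7:
  assumes "compact (UNIV :: 'k1::t2_space set)"
    and "compact (UNIV :: 'k2::t2_space set)"
    and "nontrivial_cotype TYPE('e::banach)"
    and "\<exists>T :: ('k1 \<Rightarrow>\<^sub>C real) \<Rightarrow> ('k2 \<Rightarrow>\<^sub>C 'e). isomorphic_embedding T"
    and "cinfinite (spread (UNIV :: 'k1 set))"
  shows "spread (UNIV :: 'k1 set) \<le>o spread (UNIV :: 'k2 set)"
proof -
  obtain T :: "('k1 \<Rightarrow>\<^sub>C real) \<Rightarrow> ('k2 \<Rightarrow>\<^sub>C 'e)" where T: "isomorphic_embedding T"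
    using assms(4) by (elim exE)
  define S where "S f = apply_bcontfun (T (Bcontfun f))" for f
  obtain M \<eta> N where S: "disjointly_bounded S M \<eta> N"
    using isomorphic_embedding_disjointly_bounded[OF assms(1-3) T] unfolding S_def[abs_def]
    by (elim exE)
  have "\<forall>d. \<exists>y. \<forall>U. open U \<and> d \<in> U \<longrightarrow>
      (\<exists>f. unit_fun f \<and> (\<forall>x. x \<notin> U \<longrightarrow> f x = 0) \<and> \<eta> < norm (S f y))"
    using disjointly_bounded.atom_exists[OF S] by (intro allI)
  from choice[OF this] obtain p where p: "\<forall>d U. open U \<and> d \<in> U \<longrightarrow>
      (\<exists>f. unit_fun f \<and> (\<forall>x. x \<notin> U \<longrightarrow> f x = 0) \<and> \<eta> < norm (S f (p d)))"
    by (elim exE)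
  have atoms: "disjointly_bounded_atoms S M \<eta> N D p" if "discrete D" for D
    using S that p by (simp add: disjointly_bounded_atoms_def disjointly_bounded_atoms_axioms_def)
  note inf_le = disjointly_bounded_atoms.infinite_le_spread[OF atoms]
  \<comment> \<open>The spread is a relation on the points, so its infinite field forces infinitely
    many points. The infinite discrete set then makes the second spread infinite, which settles the
    finite \<open>D\<close> below.\<close>
  have "infinite (UNIV :: 'k1 set)"
    using assms(5) finite_subset[OF subset_UNIV] unfolding cinfinite_def by blast
  then obtain D0 :: "'k1 set" where "infinite D0" "discrete D0"
    using infinite_compact_imp_infinite_discrete[OF assms(1)] by blast
  then have inf: "infinite (Field (spread (UNIV :: 'k2 set)))"
    using inf_le(1) by blast
  show ?thesis
  \<comment> \<open>The supremum may not be attained, so each discrete set is bounded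
    separately.\<close>
  proof (rule spread_least[OF Card_order_spread])
    fix D :: "'k1 set" assume "discrete D"
    then show "|D| \<le>o spread (UNIV :: 'k2 set)"
      using inf_le(2) finite_card_of_ordLeq[OF _ inf Card_order_spread] by (cases "finite D") auto
  qed
qed

end
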